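(* There exists $N_0$ such that for all integers $N\geq N_0$, the number of integers $n$ with $0\leq n<N$ satisfying $d_n\leq \frac{\log N}{100}$ is at least $N^{0.056}$.
   Context: Here $\log$ is the natural logarithm. Every nonnegative integer $n$ has a unique binary expansion $n=\sum_{i=0}^{\nu}\varepsilon_i(n)2^i$ with $\varepsilon_i(n)\in\{0,1\}$ and ($\nu=0$ or $\varepsilon_\nu(n)\neq 0$). The Van der Corput sequence in base $2$ is $\omega=(\omega_n)_{n\geq 0}$ with $\omega_n=\sum_{i=0}^{\nu}\varepsilon_i(n)2^{-i-1}$. For a sequence $x=(x_n)_{n\geq 0}$ in $[0,1)$ and an integer $N\geq 1$, the discrepancy is $D_N(x)=\sup_{0\leq a\leq b\leq 1}\left|\frac{A_N(x,a,b)}{N}-(b-a)\right|$, where $A_N(x,a,b)=|\{0\leq n<N: a\leq x_n<b\}|$; moreover $D_0(x)=0$. Set $d_N=N D_N(\omega)$ for $N\geq 0$. *)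

theory Defs
  imports "HOL-Analysis.Analysis" "HOL-Library.Discrete_Functions"
begin

(* bit n i is the binary digit of index i of n. For n > 0, floor_log n is the index of the
   leading digit; floor_log 0 = 0. *)
definition van_der_corput :: "nat \<Rightarrow> real" where
  "van_der_corput n = (\<Sum>i = 0..floor_log n. of_bool (bit n i) / 2 ^ (i + 1))"

definition count_in :: "(nat \<Rightarrow> real) \<Rightarrow> nat \<Rightarrow> real \<Rightarrow> real \<Rightarrow> nat" where
  "count_in x N a b = card {n. n < N \<and> a \<le> x n \<and> x n < b}"

(* The values lie in [0, 1], so for N > 0 the supremum is over a nonempty bounded set of reals. *)
definition discrepancy :: "(nat \<Rightarrow> real) \<Rightarrow> nat \<Rightarrow> real" where
  "discrepancy x N =
     (if N = 0 then 0
      else (SUP (a, b) \<in> {(a, b). 0 \<le> a \<and> a \<le> b \<and> b \<le> 1}.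
              \<bar>real (count_in x N a b) / real N - (b - a)\<bar>))"

definition vdc_disc :: "nat \<Rightarrow> real" where
  "vdc_disc N = real N * discrepancy van_der_corput N"

end

theory Submission
  imports Defs "HOL-Library.Nat_Bijection" "HOL-Real_Asymp.Real_Asymp"
begin

text \<open>
  A number \<open>n = (\<Sum>s\<in>S. 2^s)\<close> splits \<open>{0..<n}\<close> into \<open>card S\<close> aligned dyadic blocks. The Van der Corput
  points of an aligned block of length \<open>2\<^sup>j\<close> form a translated lattice of step \<open>1 / 2^j\<close>, so such a block
  contributes less than 1 to the unnormalised discrepancy. Hence \<open>d\<^sub>n \<le> card S\<close>, and below \<open>2\<^sup>k\<close>
  there are at least \<open>k choose t\<close> numbers with \<open>d\<^sub>n \<le> t\<close>. Taking \<open>k\<close> close to \<open>log N / log 2\<close> and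
  \<open>t\<close> close to \<open>log N / 100\<close>, a Stirling bound gives a binomial coefficient of about \<open>N powr 0.0596\<close>.
\<close>

section \<open>Digit expansion and doubling recursion of the Van der Corput sequence\<close>

lemma van_der_corput_altdef:
  assumes "n < 2 ^ K"
  shows "van_der_corput n = (\<Sum>i<K. of_bool (bit n i) / 2 ^ (i + 1))"
proof -
  have bit_lt: "\<not> bit n i" if "n < 2 ^ i" for i
    using that by (simp add: bit_iff_odd)
  have high: "\<not> bit n i" if "floor_log n < i" for i
  proof (rule bit_lt)
    have "n < 2 ^ Suc (floor_log n)"
      using floor_log_exp2_gt[of n] by simp
    also have "\<dots> \<le> 2 ^ i"
      using that by (intro power_increasing) auto
    finally show "n < 2 ^ i" .
  qed
  have highK: "\<not> bit n i" if "K \<le> i" for i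
    by (rule bit_lt, rule less_le_trans[OF assms], rule power_increasing) (use that in auto)
  show ?thesis
    unfolding van_der_corput_def
  proof (rule sum.mono_neutral_cong)
    show "of_bool (bit n i) / 2 ^ (i + 1) = (0::real)" if "i \<in> {..<K} - {0..floor_log n}" for i
      using that high by auto
    show "of_bool (bit n i) / 2 ^ (i + 1) = (0::real)" if "i \<in> {0..floor_log n} - {..<K}" for i
      using that highK by auto
  qed auto
qed

lemma van_der_corput_nonneg: "0 \<le> van_der_corput n"
  unfolding van_der_corput_def by (intro sum_nonneg) auto

lemma van_der_corput_less_1: "van_der_corput n < 1"
proof -
  have geom: "(\<Sum>i = 0..K. 1 / 2 ^ (i + 1)) = (1 - 1 / 2 ^ (K + 1) :: real)" for K
    by (induction K) (simp_all add: field_simps)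
  have "van_der_corput n \<le> (\<Sum>i = 0..floor_log n. 1 / 2 ^ (i + 1))"
    unfolding van_der_corput_def by (intro sum_mono divide_right_mono) auto
  also have "\<dots> = 1 - 1 / 2 ^ (floor_log n + 1)"
    by (rule geom)
  also have "\<dots> < 1" by simp
  finally show ?thesis .
qed

text \<open>Doubling moves every digit up one index and so halves its weight; the new lowest digit
  has weight 1/2.\<close>

lemma van_der_corput_double: "van_der_corput (2 * m) = van_der_corput m / 2"
  and van_der_corput_Suc_double: "van_der_corput (Suc (2 * m)) = van_der_corput m / 2 + 1 / 2"
proof -
  obtain K where K: "m < 2 ^ K"
    using less_exp by blast
  note expand = van_der_corput_altdef[OF K] sum.lessThan_Suc_shift sum_divide_distrib
  have "2 * m < 2 ^ Suc K" "Suc (2 * m) < 2 ^ Suc K"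
    using K by auto
  then show "van_der_corput (2 * m) = van_der_corput m / 2"
    and "van_der_corput (Suc (2 * m)) = van_der_corput m / 2 + 1 / 2"
    by (simp_all add: van_der_corput_altdef[of _ "Suc K"] expand bit_Suc bit_0 mult.commute
        del: sum.lessThan_Suc)
qed

section \<open>Counting points in aligned dyadic blocks\<close>

text \<open>Ceiling form of Hermite's identity; it merges the counts of the two halves of a
  block.\<close>

lemma ceiling_double: "\<lceil>x\<rceil> + \<lceil>x - 1 / 2\<rceil> = \<lceil>2 * x :: real\<rceil>"
proof -
  consider "\<lceil>x - 1 / 2\<rceil> = \<lceil>x\<rceil>" | "\<lceil>x - 1 / 2\<rceil> = \<lceil>x\<rceil> - 1"
    by linarith
  then show ?thesis
    by cases linarith+
qed

text \<open>The values on this block are \<open>(i + van_der_corput m) / 2 ^ j\<close> for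
  \<open>i < 2 ^ j\<close>, and the ceiling counts the \<open>i\<close> below
  \<open>2 ^ j * b - van_der_corput m\<close>. The induction halves block \<open>m\<close> into
  blocks \<open>2 * m\<close> and \<open>Suc (2 * m)\<close>.\<close>

lemma card_van_der_corput_block_less:
  assumes "0 \<le> b" "b \<le> 1"
  shows "int (card {n \<in> {m * 2 ^ j..<Suc m * 2 ^ j}. van_der_corput n < b})
    = \<lceil>2 ^ j * b - van_der_corput m\<rceil>"
proof (induction j arbitrary: m)
  case 0
  have "{n \<in> {m * 2 ^ 0..<Suc m * 2 ^ 0}. van_der_corput n < b} =
      (if van_der_corput m < b then {m} else {})"
    by auto
  then show ?case
    \<comment> \<open>Here \<open>b - van_der_corput m\<close> lies in (-1, 1], so its ceiling is 0
      or 1.\<close>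
    using assms van_der_corput_nonneg[of m] van_der_corput_less_1[of m]
    by (auto simp: ceiling_eq_iff)
next
  case (Suc j)
  let ?B = "\<lambda>m. {n \<in> {m * 2 ^ j..<Suc m * 2 ^ j}. van_der_corput n < b}"
  have "{n \<in> {m * 2 ^ Suc j..<Suc m * 2 ^ Suc j}. van_der_corput n < b}
      = ?B (2 * m) \<union> ?B (Suc (2 * m))"
    by auto
  moreover have "?B (2 * m) \<inter> ?B (Suc (2 * m)) = {}"
    by auto
  ultimately have "int (card {n \<in> {m * 2 ^ Suc j..<Suc m * 2 ^ Suc j}. van_der_corput n < b})
      = int (card (?B (2 * m))) + int (card (?B (Suc (2 * m))))"
    by (simp add: card_Un_disjoint del: mult_Suc)
  also have "\<dots> = \<lceil>2 ^ j * b - van_der_corput m / 2\<rceil>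
      + \<lceil>2 ^ j * b - van_der_corput m / 2 - 1 / 2\<rceil>"
    unfolding Suc van_der_corput_double van_der_corput_Suc_double by (simp add: algebra_simps)
  also have "\<dots> = \<lceil>2 ^ Suc j * b - van_der_corput m\<rceil>"
    unfolding ceiling_double by (simp add: algebra_simps)
  finally show ?case .
qed

text \<open>The count is a difference of two ceilings; the shift \<open>van_der_corput m\<close>
  cancels and rounding costs less than 1.\<close>

lemma card_van_der_corput_block:
  assumes "0 \<le> a" "a \<le> b" "b \<le> 1"
  shows "\<bar>real (card {n \<in> {m * 2 ^ j..<Suc m * 2 ^ j}. a \<le> van_der_corput n \<and> van_der_corput n < b})
    - 2 ^ j * (b - a)\<bar> \<le> 1"
proof -
  let ?L = "\<lambda>c. {n \<in> {m * 2 ^ j..<Suc m * 2 ^ j}. van_der_corput n < c}"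
  have "{n \<in> {m * 2 ^ j..<Suc m * 2 ^ j}. a \<le> van_der_corput n \<and> van_der_corput n < b} = ?L b - ?L a"
    by auto
  moreover have sub: "?L a \<subseteq> ?L b"
    using assms by auto
  moreover have "card (?L a) \<le> card (?L b)"
    using sub by (intro card_mono) auto
  ultimately have "real (card {n \<in> {m * 2 ^ j..<Suc m * 2 ^ j}. a \<le> van_der_corput n \<and> van_der_corput n < b})
      = of_int (int (card (?L b))) - of_int (int (card (?L a)))"
    by (simp add: card_Diff_subset of_nat_diff del: mult_Suc)
  also have "\<dots> = of_int \<lceil>2 ^ j * b - van_der_corput m\<rceil> - of_int \<lceil>2 ^ j * a - van_der_corput m\<rceil>"
    using assms by (simp only: card_van_der_corput_block_less order.trans)
  finally show ?thesis
    by (simp only: right_diff_distrib) linarith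
qed

section \<open>Discrepancy bounded by the binary digit sum\<close>

lemma count_in_van_der_corput_set_encode:
  assumes "finite S" "0 \<le> a" "a \<le> b" "b \<le> 1"
  shows "\<bar>real (count_in van_der_corput (set_encode S) a b) - real (set_encode S) * (b - a)\<bar>
    \<le> real (card S)"
  using assms(1)
\<comment> \<open>Each inserted exponent \<open>s\<close> is below all earlier ones, so
  \<open>2 ^ s\<close> divides \<open>set_encode S\<close> and the appended block is
  aligned.\<close>
proof (induction rule: finite_linorder_min_induct)
  case empty
  then show ?case by (simp add: count_in_def)
next
  case (insert s S)
  let ?P = "\<lambda>n. a \<le> van_der_corput n \<and> van_der_corput n < b"
  have "2 ^ s dvd set_encode S"
    unfolding set_encode_def using insert by (intro dvd_sum le_imp_power_dvd) (auto simp: less_imp_le)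
  then obtain m where m: "set_encode S = m * 2 ^ s"
    by (metis dvd_def mult.commute)
  have enc: "set_encode (insert s S) = set_encode S + 2 ^ s"
    using insert by (subst set_encode_insert) auto
  have "{n. n < set_encode (insert s S) \<and> ?P n}
      = {n. n < set_encode S \<and> ?P n} \<union> {n \<in> {m * 2 ^ s..<Suc m * 2 ^ s}. ?P n}"
    unfolding enc m by auto
  moreover have "{n. n < set_encode S \<and> ?P n} \<inter> {n \<in> {m * 2 ^ s..<Suc m * 2 ^ s}. ?P n} = {}"
    unfolding m by auto
  ultimately have "count_in van_der_corput (set_encode (insert s S)) a b
      = count_in van_der_corput (set_encode S) a b + card {n \<in> {m * 2 ^ s..<Suc m * 2 ^ s}. ?P n}"
    unfolding count_in_def by (simp add: card_Un_disjoint del: mult_Suc)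
  moreover have "card (insert s S) = Suc (card S)"
    using insert by auto
  ultimately show ?case
    using insert.IH card_van_der_corput_block[OF assms(2-4), of m s] unfolding enc
    by (simp add: algebra_simps del: mult_Suc)
qed

lemma vdc_disc_set_encode_le:
  assumes "finite S"
  shows "vdc_disc (set_encode S) \<le> real (card S)"
proof (cases "set_encode S = 0")
  case False
  let ?n = "set_encode S"
  have "discrepancy van_der_corput ?n \<le> real (card S) / real ?n"
    unfolding discrepancy_def using False
  proof (simp only: if_False, intro cSUP_least)
    show "{(a, b). 0 \<le> a \<and> a \<le> b \<and> b \<le> (1::real)} \<noteq> {}"
      by (auto intro!: exI[of _ 0])
    fix p :: "real \<times> real"
    assume "p \<in> {(a, b). 0 \<le> a \<and> a \<le> b \<and> b \<le> 1}"
    then obtain a b where p: "p = (a, b)" "0 \<le> a" "a \<le> b" "b \<le> 1"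
      by auto
    have "\<bar>real (count_in van_der_corput ?n a b) / real ?n - (b - a)\<bar>
        = \<bar>(real (count_in van_der_corput ?n a b) - real ?n * (b - a)) / real ?n\<bar>"
      using False by (simp add: diff_divide_distrib)
    also have "\<dots> = \<bar>real (count_in van_der_corput ?n a b) - real ?n * (b - a)\<bar> / real ?n"
      by (simp only: abs_divide abs_of_nat)
    also have "\<dots> \<le> real (card S) / real ?n"
      by (intro divide_right_mono count_in_van_der_corput_set_encode assms p) auto
    finally show "(case p of (a, b) \<Rightarrow>
        \<bar>real (count_in van_der_corput ?n a b) / real ?n - (b - a)\<bar>) \<le> real (card S) / real ?n"
      by (simp add: p)
  qed
  then show ?thesis
    using False by (simp add: vdc_disc_def field_simps)
qed (simp add: vdc_disc_def)

lemma set_encode_less: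
  assumes "S \<subseteq> {..<k}"
  shows "set_encode S < 2 ^ k"
proof -
  have "set_encode S \<le> (\<Sum>i<k. 2 ^ i)"
    unfolding set_encode_def using assms by (intro sum_mono2) auto
  then show ?thesis
    by (simp add: lessThan_atLeast0 sum_power2 flip: less_eq_Suc_le) (metis Suc_pred le_imp_less_Suc zero_less_numeral zero_less_power)
qed

lemma binomial_le_card_vdc_disc_le:
  assumes "2 ^ k \<le> N" "real t \<le> c"
  shows "k choose t \<le> card {n. n < N \<and> vdc_disc n \<le> c}"
proof -
  let ?A = "{S. S \<subseteq> {..<k} \<and> card S = t}"
  have fin: "finite S" if "S \<subseteq> {..<k}" for S
    using that finite_subset by blast
  have "k choose t = card ?A"
    by (simp add: n_subsets)
  also have "\<dots> = card (set_encode ` ?A)"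
    by (intro card_image[symmetric] inj_on_subset[OF inj_on_set_encode]) (auto intro: fin)
  also have "\<dots> \<le> card {n. n < N \<and> vdc_disc n \<le> c}"
  proof (intro card_mono)
    show "set_encode ` ?A \<subseteq> {n. n < N \<and> vdc_disc n \<le> c}"
    proof safe
      fix S assume S: "S \<subseteq> {..<k}" "t = card S"
      show "set_encode S < N"
        using set_encode_less[OF S(1)] assms by simp
      show "vdc_disc (set_encode S) \<le> c"
        using vdc_disc_set_encode_le[OF fin[OF S(1)]] assms S by simp
    qed
  qed auto
  finally show ?thesis .
qed

section \<open>Lower bounds for binomial coefficients\<close>

text \<open>The right-hand side is the falling factorial of \<open>k\<close> with \<open>t\<close>
  factors, each at least \<open>m\<close>.\<close>

lemma power_le_binomial_mult_fact:
  assumes "t + m \<le> k"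
  shows "m ^ t \<le> (k choose t) * fact t"
  using assms
proof (induction t)
  case (Suc t)
  have "m ^ Suc t \<le> (k - t) * ((k choose t) * fact t)"
    using Suc by (simp add: mult_mono)
  also have "\<dots> = (k choose Suc t) * fact (Suc t)"
    using binomial_absorb_comp[of k t] binomial_absorption[of t k]
    by (metis (no_types, lifting) fact_Suc mult.assoc mult.commute of_nat_id)
  finally show ?case .
qed simp

text \<open>A weak Stirling bound, \<open>t! \<le> e * t * (t / e) ^ t\<close>. The induction step
  amounts to \<open>(1 + 1 / t) ^ (t + 1) \<ge> e\<close>.\<close>

lemma ln_fact_le:
  assumes "t > 0"
  shows "ln (fact t) \<le> 1 + (real t + 1) * ln (real t) - real t"
  using assms
proof (induction t rule: nat_induct_non_zero)
  case (Suc t)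
  have "ln (real t / (real t + 1)) \<le> real t / (real t + 1) - 1"
    using Suc by (intro ln_le_minus_one) auto
  also have "\<dots> = - (1 / (real t + 1))"
    by (simp add: field_simps)
  finally have "1 / (real t + 1) \<le> ln (real t + 1) - ln (real t)"
    using Suc by (simp add: ln_div)
  then have "1 \<le> (real t + 1) * (ln (real t + 1) - ln (real t))"
    by (simp add: field_simps)
  moreover have "ln (fact (Suc t)) = ln (real t + 1) + ln (fact t)"
    using Suc by (simp add: ln_mult add_ac)
  ultimately show ?case
    using Suc by (simp add: algebra_simps)
qed simp

lemma ln_120_ge: "4.7 \<le> ln (120 :: real)"
proof -
  have e: "exp 1 \<le> (2.72 :: real)"
    using e_less_272 by simp
  \<comment> \<open>Tenth powers make the exponent an integer, leaving a comparison of
    rationals.\<close>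
  have "exp 4.7 ^ 10 = (exp 1 :: real) ^ 47"
    by (simp flip: exp_of_nat_mult)
  also have "\<dots> \<le> 2.72 ^ 47"
    by (intro power_mono e) auto
  also have "\<dots> \<le> 120 ^ 10"
    by (simp add: power_divide field_simps)
  finally have "exp 4.7 \<le> (120 :: real)"
    by (subst (asm) power_mono_iff) auto
  then show ?thesis
    by (subst ln_ge_iff) auto
qed

text \<open>Take \<open>m = 120 * t\<close> in the power bound. The slope 5.7 is 4.7 from
  \<open>ln 120\<close> plus 1 from the term \<open>- real t\<close> in the factorial bound.\<close>

lemma ln_binomial_ge:
  assumes "t > 0" "121 * t \<le> k"
  shows "5.7 * real t - 1 - ln (real t) \<le> ln (real (k choose t))"
proof -
  have pos: "0 < k choose t"
    using assms by simp
  have "real ((120 * t) ^ t) \<le> real ((k choose t) * fact t)"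
    using assms by (intro of_nat_mono power_le_binomial_mult_fact) auto
  then have "(120 * real t) ^ t \<le> real (k choose t) * fact t"
    by simp
  then have "ln ((120 * real t) ^ t) \<le> ln (real (k choose t) * fact t)"
    using assms pos by (subst ln_le_cancel_iff) auto
  then have "real t * ln 120 + real t * ln (real t) \<le> ln (real (k choose t)) + ln (fact t)"
    using assms pos by (simp add: ln_realpow ln_mult distrib_left)
  moreover have "real t * 4.7 \<le> real t * ln 120"
    using ln_120_ge by (intro mult_left_mono) auto
  ultimately show ?thesis
    using ln_fact_le[OF assms(1)] by (simp add: algebra_simps)
qed

theorem theorem2p2:
  shows "\<exists>N0 :: nat. \<forall>N \<ge> N0.
    real (card {n. n < N \<and> vdc_disc n \<le> ln (real N) / 100}) \<ge> real N powr 0.056"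
proof -
  \<comment> \<open>Since \<open>ln N / 100 < t + 1\<close>, the target \<open>0.056 * ln N\<close>
    is below \<open>5.6 * (t + 1)\<close>; the spare \<open>0.1 * t\<close> absorbs the constants
    and \<open>ln t\<close>.\<close>
  have "eventually (\<lambda>t. 5.6 * (real t + 1) \<le> 5.7 * real t - 1 - ln (real t)) at_top"
    by real_asymp
  then obtain T where T: "\<And>t. t \<ge> T \<Longrightarrow> 5.6 * (real t + 1) \<le> 5.7 * real t - 1 - ln (real t)"
    by (auto simp: eventually_at_top_linorder)
  have "eventually (\<lambda>N. real T + 1 \<le> ln (real N) / 100) at_top"
    by real_asymp
  then obtain N0 where N0: "\<And>N. N \<ge> N0 \<Longrightarrow> real T + 1 \<le> ln (real N) / 100"
    by (auto simp: eventually_at_top_linorder)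
  show ?thesis
  proof (intro exI[of _ N0] allI impI)
    fix N assume "N \<ge> N0"
    note big = N0[OF this]
    \<comment> \<open>\<open>N = 0\<close> would contradict \<open>big\<close>, because
      \<open>ln 0 = 0\<close>.\<close>
    then have N: "N > 0"
      by (cases "N = 0") auto
    define t where "t = nat \<lfloor>ln (real N) / 100\<rfloor>"
    \<comment> \<open>The largest \<open>k\<close> with \<open>2 ^ k \<le> N\<close>, so every
      encoded subset of \<open>{..<k}\<close> is below \<open>N\<close>.\<close>
    define k where "k = floor_log N"
    have t: "real t \<le> ln (real N) / 100" "ln (real N) / 100 < real t + 1"
      unfolding t_def using big by linarith+
    have "t \<ge> T" "t > 0"
      using t big by linarith+
    have "N < 2 ^ (k + 1)"
      unfolding k_def using floor_log_exp2_gt[of N] by simp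
    then have "real N < real (2 ^ (k + 1))"
      by (simp only: of_nat_less_iff)
    then have "real N < 2 ^ (k + 1)"
      by (simp only: of_nat_power of_nat_numeral)
    then have "ln (real N) < ln (2 ^ (k + 1))"
      using N by (subst ln_less_cancel_iff) auto
    also have "\<dots> = real (k + 1) * ln 2"
      by (simp only: ln_realpow zero_less_numeral)
    also have "\<dots> \<le> real (k + 1) * (25 / 36)"
      using ln2_le_25_over_36 by (intro mult_left_mono) auto
    \<comment> \<open>From \<open>100 * t \<le> ln N < (k + 1) * 25 / 36\<close> follows
      \<open>144 * t < k + 1\<close>; as \<open>t > 0\<close>, the surplus over
      \<open>121 * t\<close> covers the 1.\<close>
    finally have "real (121 * t) \<le> real k"
      using t \<open>t > 0\<close> by simp
    then have k: "121 * t \<le> k"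
      by linarith
    have "ln (real N powr 0.056) = 0.056 * ln (real N)"
      using N by (simp add: ln_powr)
    also have "\<dots> \<le> 5.6 * (real t + 1)"
      using t by simp
    also have "\<dots> \<le> ln (real (k choose t))"
      using T[OF \<open>t \<ge> T\<close>] ln_binomial_ge[OF \<open>t > 0\<close> k] by linarith
    finally have "real N powr 0.056 \<le> real (k choose t)"
      using N k by (subst (asm) ln_le_cancel_iff) auto
    also have "\<dots> \<le> real (card {n. n < N \<and> vdc_disc n \<le> ln (real N) / 100})"
      using binomial_le_card_vdc_disc_le[OF _ t(1)] floor_log_exp2_le[OF N] by (simp add: k_def)
    finally show "real N powr 0.056 \<le> real (card {n. n < N \<and> vdc_disc n \<le> ln (real N) / 100})" .
  qed
qed

end
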